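(* Let $p$ be a prime number, $q$ an integer with $1<q<p$, $\psi:\mathbf{N}\to\overline{\mathbf{N}}$ an admissible function, and $(a_n)_{n\in\mathbf{N}_\psi}$ a family of integers with values in $\{1,\dots,p-1\}$. The power series $G_\psi(T)=\sum_{n\in\mathbf{N}_\psi}a_n p^{\psi(n)}T^n$ is rational (i.e. is the expansion of a rational fraction) if and only if its value $G_\psi(1/q)$, computed in $\mathbf{Q}_p$, is a rational number.
   Context: $\mathbf{N}=\{0,1,2,\dots\}$ and $\overline{\mathbf{N}}=\mathbf{N}\cup\{+\infty\}$. A map $\psi:\mathbf{N}\to\overline{\mathbf{N}}$ is called admissible if (1) the set $\mathbf{N}_\psi=\psi^{-1}(\mathbf{N})$ is either of the form $\{i\in\mathbf{N}: i\le N\}$ for some $N$, or equal to $\mathbf{N}$; and (2) $\psi$ is strictly increasing on $\mathbf{N}_\psi$. *)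

theory Defs
  imports "HOL-Analysis.Analysis" "HOL-Computational_Algebra.Polynomial_FPS"
    "HOL-Library.Extended_Nat"
begin

definition admissible :: "(nat \<Rightarrow> enat) \<Rightarrow> bool" where
  "admissible \<psi> \<longleftrightarrow>
     ((\<exists>N. {i. \<psi> i \<noteq> \<infinity>} = {i. i \<le> N}) \<or> {i. \<psi> i \<noteq> \<infinity>} = UNIV) \<and>
     strict_mono_on {i. \<psi> i \<noteq> \<infinity>} \<psi>"

definition G_series :: "nat \<Rightarrow> (nat \<Rightarrow> enat) \<Rightarrow> (nat \<Rightarrow> int) \<Rightarrow> rat fps" where
  "G_series p \<psi> a =
     Abs_fps (\<lambda>n. if \<psi> n \<noteq> \<infinity> then of_int (a n) * of_nat p ^ the_enat (\<psi> n) else 0)"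

(* A rational fraction has a power series expansion (at 0) iff it has a representation
   P / Q with Q(0) nonzero. *)
definition fps_rational :: "'a::field fps \<Rightarrow> bool" where
  "fps_rational F \<longleftrightarrow>
     (\<exists>P Q. coeff Q 0 \<noteq> 0 \<and> F = fps_of_poly P / fps_of_poly Q)"

definition padic_val :: "nat \<Rightarrow> rat \<Rightarrow> int" where
  "padic_val p x =
     (case quotient_of x of (a, b) \<Rightarrow>
        int (multiplicity (int p) a) - int (multiplicity (int p) b))"

definition padic_abs :: "nat \<Rightarrow> rat \<Rightarrow> real" where
  "padic_abs p x = (if x = 0 then 0 else real p powi (- padic_val p x))"

definition padic_dist :: "nat \<Rightarrow> rat \<Rightarrow> rat \<Rightarrow> real" where
  "padic_dist p x y = padic_abs p (x - y)"

(* The field of p-adic numbers as the completion of the rationals: Cauchy sequences of rationals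
   modulo sequences of p-adic distance tending to 0. *)
definition padic_Cauchy :: "nat \<Rightarrow> (nat \<Rightarrow> rat) set" where
  "padic_Cauchy p = {x. Metric_space.MCauchy UNIV (padic_dist p) x}"

definition padic_rel :: "nat \<Rightarrow> ((nat \<Rightarrow> rat) \<times> (nat \<Rightarrow> rat)) set" where
  "padic_rel p = {(x, y). x \<in> padic_Cauchy p \<and> y \<in> padic_Cauchy p \<and>
     (\<lambda>n. padic_dist p (x n) (y n)) \<longlonglongrightarrow> 0}"

definition Qp :: "nat \<Rightarrow> (nat \<Rightarrow> rat) set set" where
  "Qp p = padic_Cauchy p // padic_rel p"

(* The locale Metric_space asks for a total nonnegative symmetric function, whence the value 0
   outside the carrier. *)
definition Qp_dist :: "nat \<Rightarrow> (nat \<Rightarrow> rat) set \<Rightarrow> (nat \<Rightarrow> rat) set \<Rightarrow> real" where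
  "Qp_dist p X Y =
     (if X \<in> Qp p \<and> Y \<in> Qp p
      then THE d. \<forall>x\<in>X. \<forall>y\<in>Y. (\<lambda>n. padic_dist p (x n) (y n)) \<longlonglongrightarrow> d
      else 0)"

definition Qp_of_rat :: "nat \<Rightarrow> rat \<Rightarrow> (nat \<Rightarrow> rat) set" where
  "Qp_of_rat p r = padic_rel p `` {\<lambda>_. r}"

lemma padic_val_quotient:
  assumes "prime p" "a \<noteq> 0" "b \<noteq> 0"
  shows "padic_val p (of_int a / of_int b) =
           int (multiplicity (int p) a) - int (multiplicity (int p) b)"
proof -
  obtain c d where cd: "quotient_of (of_int a / of_int b) = (c, d)" by force
  have d: "d > 0" using quotient_of_denom_pos[OF cd] .
  have eq: "(of_int a / of_int b :: rat) = of_int c / of_int d" using quotient_of_div[OF cd] .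
  then have "(of_int (a * d) :: rat) = of_int (c * b)" using assms d by (simp add: field_simps)
  then have ad: "a * d = c * b" using of_int_eq_iff by blast
  then have c: "c \<noteq> 0" using assms d by auto
  have P: "prime_elem (int p)" using assms(1) by simp
  have "multiplicity (int p) (a * d) = multiplicity (int p) a + multiplicity (int p) d"
    using assms d by (intro prime_elem_multiplicity_mult_distrib[OF P]) auto
  moreover have "multiplicity (int p) (c * b) = multiplicity (int p) c + multiplicity (int p) b"
    using assms c by (intro prime_elem_multiplicity_mult_distrib[OF P]) auto
  ultimately show ?thesis using cd ad unfolding padic_val_def by simp
qed

lemma padic_val_add:
  assumes "prime p" "x \<noteq> 0" "y \<noteq> 0" "x + y \<noteq> 0"
  shows "min (padic_val p x) (padic_val p y) \<le> padic_val p (x + y)"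
proof -
  obtain a b where ab: "quotient_of x = (a, b)" by force
  obtain c d where cd: "quotient_of y = (c, d)" by force
  have b: "b > 0" and d: "d > 0" using ab cd quotient_of_denom_pos by blast+
  have x: "x = of_int (a * d) / of_int (b * d)" and y: "y = of_int (c * b) / of_int (b * d)"
    using quotient_of_div[OF ab] quotient_of_div[OF cd] b d by (auto simp: field_simps)
  then have xy: "x + y = of_int (a * d + c * b) / of_int (b * d)" by (simp add: add_divide_distrib)
  have nz: "a * d \<noteq> 0" "c * b \<noteq> 0" "a * d + c * b \<noteq> 0" "b * d \<noteq> 0"
    using x y xy assms b d by (auto simp del: of_int_add of_int_mult)
  let ?m = "min (multiplicity (int p) (a * d)) (multiplicity (int p) (c * b))"
  have "int p ^ ?m dvd a * d + c * b"
    by (intro dvd_add multiplicity_dvd') auto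
  moreover have "\<not> is_unit (int p)" using prime_gt_1_nat[OF assms(1)] by simp
  ultimately have "?m \<le> multiplicity (int p) (a * d + c * b)" using nz by (intro multiplicity_geI) auto
  then show ?thesis
    unfolding xy unfolding x y
    using padic_val_quotient[OF assms(1) nz(1) nz(4)] padic_val_quotient[OF assms(1) nz(2) nz(4)]
      padic_val_quotient[OF assms(1) nz(3) nz(4)] by linarith
qed

lemma padic_abs_ultra:
  assumes "prime p"
  shows "padic_abs p (x + y) \<le> max (padic_abs p x) (padic_abs p y)"
proof (cases "x = 0 \<or> y = 0 \<or> x + y = 0")
  case True
  then show ?thesis using prime_gt_0_nat[OF assms] by (auto simp: padic_abs_def max_def)
next
  case False
  then have "min (padic_val p x) (padic_val p y) \<le> padic_val p (x + y)"
    using padic_val_add assms by blast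
  moreover have "1 \<le> real p" using prime_ge_1_nat[OF assms] by simp
  ultimately have "real p powi (- padic_val p (x + y)) \<le> real p powi (- padic_val p x) \<or>
    real p powi (- padic_val p (x + y)) \<le> real p powi (- padic_val p y)"
    by (auto simp: min_le_iff_disj intro!: power_int_increasing)
  then show ?thesis using False by (auto simp: padic_abs_def)
qed

lemma Metric_space_padic_dist:
  assumes "prime p"
  shows "Metric_space UNIV (padic_dist p)"
proof
  have p: "real p > 0" using prime_gt_0_nat[OF assms] by simp
  have nonneg: "padic_abs p x \<ge> 0" for x using p by (simp add: padic_abs_def)
  show "0 \<le> padic_dist p x y" for x y by (simp add: padic_dist_def nonneg)
  show "padic_dist p x y = padic_dist p y x" for x y
  proof -
    have "padic_val p (- z) = padic_val p z" for z
      using multiplicity_times_unit_right[of "- 1" "int p"]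
      by (simp add: padic_val_def rat_uminus_code split: prod.splits)
    from this[of "x - y"] show ?thesis by (auto simp: padic_dist_def padic_abs_def)
  qed
  show "padic_dist p x y = 0 \<longleftrightarrow> x = y" for x y using p by (simp add: padic_dist_def padic_abs_def)
  show "padic_dist p x z \<le> padic_dist p x y + padic_dist p y z" for x y z
    using padic_abs_ultra[OF assms, of "x - y" "y - z"] nonneg[of "x - y"] nonneg[of "y - z"]
    by (simp add: padic_dist_def)
qed

lemma equiv_padic_rel:
  assumes "prime p"
  shows "equiv (padic_Cauchy p) (padic_rel p)"
proof -
  interpret Metric_space UNIV "padic_dist p" by (rule Metric_space_padic_dist[OF assms])
  show ?thesis
  proof (rule equivI)
    show "padic_rel p \<subseteq> padic_Cauchy p \<times> padic_Cauchy p" by (auto simp: padic_rel_def)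
    show "refl_on (padic_Cauchy p) (padic_rel p)" by (auto simp: padic_rel_def refl_on_def)
    show "sym (padic_rel p)" by (auto simp: padic_rel_def sym_def commute)
    show "trans (padic_rel p)"
    proof (rule transI)
      fix x y z assume "(x, y) \<in> padic_rel p" "(y, z) \<in> padic_rel p"
      then have *: "x \<in> padic_Cauchy p" "z \<in> padic_Cauchy p"
        "(\<lambda>n. padic_dist p (x n) (y n)) \<longlonglongrightarrow> 0" "(\<lambda>n. padic_dist p (y n) (z n)) \<longlonglongrightarrow> 0"
        by (auto simp: padic_rel_def)
      have "(\<lambda>n. padic_dist p (x n) (z n)) \<longlonglongrightarrow> 0"
        using tendsto_add_zero[OF *(3,4)]
        by (rule Lim_null_comparison[rotated]) (simp add: triangle)
      with * show "(x, z) \<in> padic_rel p" by (simp add: padic_rel_def)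
    qed
  qed
qed

lemma padic_dist_tendsto:
  assumes "prime p" "x \<in> padic_Cauchy p" "y \<in> padic_Cauchy p"
  shows "\<exists>d. (\<lambda>n. padic_dist p (x n) (y n)) \<longlonglongrightarrow> d"
proof -
  interpret Metric_space UNIV "padic_dist p" by (rule Metric_space_padic_dist[OF assms(1)])
  have "Cauchy (\<lambda>n. padic_dist p (x n) (y n))"
  proof (rule metric_CauchyI)
    fix e :: real assume "e > 0"
    then have e: "e / 2 > 0" by simp
    have ex: "\<exists>N. \<forall>m n. N \<le> m \<longrightarrow> N \<le> n \<longrightarrow> padic_dist p (u m) (u n) < e / 2"
      if "u \<in> padic_Cauchy p" for u
      using that e unfolding padic_Cauchy_def MCauchy_def mem_Collect_eq by blast
    obtain N1 N2 where
      N1: "\<And>m n. m \<ge> N1 \<Longrightarrow> n \<ge> N1 \<Longrightarrow> padic_dist p (x m) (x n) < e / 2" and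
      N2: "\<And>m n. m \<ge> N2 \<Longrightarrow> n \<ge> N2 \<Longrightarrow> padic_dist p (y m) (y n) < e / 2"
      using ex[OF assms(2)] ex[OF assms(3)] by blast
    show "\<exists>M. \<forall>m\<ge>M. \<forall>n\<ge>M. dist (padic_dist p (x m) (y m)) (padic_dist p (x n) (y n)) < e"
    proof (intro exI[of _ "max N1 N2"] allI impI)
      fix m n assume "m \<ge> max N1 N2" "n \<ge> max N1 N2"
      then show "dist (padic_dist p (x m) (y m)) (padic_dist p (x n) (y n)) < e"
        using N1[of m n] N2[of m n] triangle[of "x m" "x n" "y m"] triangle[of "x n" "y n" "y m"]
          triangle[of "x n" "x m" "y n"] triangle[of "x m" "y m" "y n"]
          commute[of "x m" "x n"] commute[of "y m" "y n"]
        by (auto simp: dist_real_def abs_less_iff)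
    qed
  qed
  then show ?thesis using real_Cauchy_convergent by (simp add: convergent_def)
qed

lemma Qp_dist_tendsto:
  assumes "prime p" "X \<in> Qp p" "Y \<in> Qp p" "x \<in> X" "y \<in> Y"
  shows "(\<lambda>n. padic_dist p (x n) (y n)) \<longlonglongrightarrow> Qp_dist p X Y"
proof -
  interpret Metric_space UNIV "padic_dist p" by (rule Metric_space_padic_dist[OF assms(1)])
  note eq = equiv_padic_rel[OF assms(1)]
  have rel: "(u, v) \<in> padic_rel p" if "Z \<in> Qp p" "u \<in> Z" "v \<in> Z" for u v Z
    using quotient_eq_iff[OF eq] that unfolding Qp_def by blast
  obtain d where d: "(\<lambda>n. padic_dist p (x n) (y n)) \<longlonglongrightarrow> d"
    using padic_dist_tendsto[OF assms(1)] rel[OF assms(2,4,4)] rel[OF assms(3,5,5)]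
    unfolding padic_rel_def by blast
  have all: "(\<lambda>n. padic_dist p (u n) (v n)) \<longlonglongrightarrow> d" if "u \<in> X" "v \<in> Y" for u v
  proof -
    have "(\<lambda>n. padic_dist p (x n) (u n)) \<longlonglongrightarrow> 0" "(\<lambda>n. padic_dist p (y n) (v n)) \<longlonglongrightarrow> 0"
      using rel[OF assms(2) assms(4) that(1)] rel[OF assms(3) assms(5) that(2)]
      by (auto simp: padic_rel_def)
    from tendsto_add_zero[OF this]
    have "(\<lambda>n. padic_dist p (u n) (v n) - padic_dist p (x n) (y n)) \<longlonglongrightarrow> 0"
    proof (rule Lim_null_comparison[rotated], intro always_eventually allI)
      fix n
      show "norm (padic_dist p (u n) (v n) - padic_dist p (x n) (y n))
              \<le> padic_dist p (x n) (u n) + padic_dist p (y n) (v n)"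
        using triangle[of "u n" "x n" "v n"] triangle[of "x n" "y n" "v n"]
          triangle[of "x n" "u n" "y n"] triangle[of "u n" "v n" "y n"]
          commute[of "x n" "u n"] commute[of "y n" "v n"]
        by (auto simp: abs_le_iff)
    qed
    from tendsto_add[OF this d] show ?thesis by simp
  qed
  have "Qp_dist p X Y = d"
    unfolding Qp_dist_def using all assms(2-5) d
    by (simp, intro the_equality) (blast intro: LIMSEQ_unique)+
  with d show ?thesis by simp
qed

lemma Metric_space_Qp:
  assumes "prime p"
  shows "Metric_space (Qp p) (Qp_dist p)"
proof -
  interpret P: Metric_space UNIV "padic_dist p" by (rule Metric_space_padic_dist[OF assms])
  note eq = equiv_padic_rel[OF assms]
  have ne: "\<exists>x. x \<in> X" if "X \<in> Qp p" for X
    using that in_quotient_imp_non_empty[OF eq] unfolding Qp_def by blast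
  have C: "x \<in> padic_Cauchy p" if "X \<in> Qp p" "x \<in> X" for X x
    using that in_quotient_imp_subset[OF eq] unfolding Qp_def by blast
  show ?thesis
  proof
    show "0 \<le> Qp_dist p X Y" for X Y
    proof (cases "X \<in> Qp p \<and> Y \<in> Qp p")
      case True
      then obtain x y where "x \<in> X" "y \<in> Y" using ne by blast
      then show ?thesis
        using Qp_dist_tendsto[OF assms, of X Y x y] True
        by (intro LIMSEQ_le_const[of _ "Qp_dist p X Y"]) auto
    qed (auto simp: Qp_dist_def)
    show "Qp_dist p X Y = Qp_dist p Y X" for X Y
    proof (cases "X \<in> Qp p \<and> Y \<in> Qp p")
      case True
      then obtain x y where "x \<in> X" "y \<in> Y" using ne by blast
      then show ?thesis
        using Qp_dist_tendsto[OF assms, of X Y x y] Qp_dist_tendsto[OF assms, of Y X y x] True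
        by (auto simp: P.commute intro: LIMSEQ_unique)
    qed (auto simp: Qp_dist_def)
    show "Qp_dist p X Y = 0 \<longleftrightarrow> X = Y" if XY: "X \<in> Qp p" "Y \<in> Qp p" for X Y
    proof -
      obtain x y where xy: "x \<in> X" "y \<in> Y" using ne XY by blast
      have "X = Y \<longleftrightarrow> (x, y) \<in> padic_rel p"
        using quotient_eq_iff[OF eq that[unfolded Qp_def] xy] .
      also have "\<dots> \<longleftrightarrow> (\<lambda>n. padic_dist p (x n) (y n)) \<longlonglongrightarrow> 0"
        using C that xy by (auto simp: padic_rel_def)
      also have "\<dots> \<longleftrightarrow> Qp_dist p X Y = 0"
        using Qp_dist_tendsto[OF assms that xy] LIMSEQ_unique by auto
      finally show ?thesis by simp
    qed
    show "Qp_dist p X Z \<le> Qp_dist p X Y + Qp_dist p Y Z"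
      if XYZ: "X \<in> Qp p" "Y \<in> Qp p" "Z \<in> Qp p" for X Y Z
    proof -
      obtain x y z where xyz: "x \<in> X" "y \<in> Y" "z \<in> Z" using ne[OF XYZ(1)] ne[OF XYZ(2)] ne[OF XYZ(3)] by blast
      show ?thesis
        using Qp_dist_tendsto[OF assms that(1,3) xyz(1,3)]
          tendsto_add[OF Qp_dist_tendsto[OF assms that(1,2) xyz(1,2)]
            Qp_dist_tendsto[OF assms that(2,3) xyz(2,3)]]
        by (rule LIMSEQ_le) (simp add: P.triangle)
    qed
  qed
qed

lemma Qp_of_rat_mem:
  assumes "prime p"
  shows "Qp_of_rat p r \<in> Qp p"
proof -
  interpret P: Metric_space UNIV "padic_dist p" by (rule Metric_space_padic_dist[OF assms])
  show ?thesis unfolding Qp_of_rat_def Qp_def by (rule quotientI) (simp add: padic_Cauchy_def)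
qed

lemma Qp_dist_of_rat:
  assumes "prime p"
  shows "Qp_dist p (Qp_of_rat p r) (Qp_of_rat p s) = padic_dist p r s"
proof -
  interpret P: Metric_space UNIV "padic_dist p" by (rule Metric_space_padic_dist[OF assms])
  have "(\<lambda>_. t) \<in> Qp_of_rat p t" for t
    unfolding Qp_of_rat_def
    by (rule equiv_class_self[OF equiv_padic_rel[OF assms]]) (simp add: padic_Cauchy_def)
  from Qp_dist_tendsto[OF assms Qp_of_rat_mem[OF assms] Qp_of_rat_mem[OF assms] this this, of r s]
  show ?thesis by (simp add: LIMSEQ_const_iff)
qed

(* The value in the p-adic numbers of a power series with rational coefficients at a rational
   point: its partial sums are rational, so only the embedding of the rationals is needed. *)
definition Qp_eval :: "nat \<Rightarrow> rat fps \<Rightarrow> rat \<Rightarrow> (nat \<Rightarrow> rat) set \<Rightarrow> bool" where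
  "Qp_eval p F x v \<longleftrightarrow>
     limitin (Metric_space.mtopology (Qp p) (Qp_dist p))
       (\<lambda>N. Qp_of_rat p (\<Sum>n<N. fps_nth F n * x ^ n)) v sequentially"

end

theory Submission
  imports Defs
begin

text \<open>
  Only the case where \<psi> is finite everywhere has content: otherwise the series is a polynomial.

  A rational series takes a rational value for a general reason. If F = P / Q and the terms of F at
  x are p-adically null, then the partial sums s of F satisfy Q(x) s - P(x) \<rightarrow> 0
  (\<open>psum_mult_poly\<close>). When Q(x) is nonzero, s tends to P(x) / Q(x); when Q(x) = 0, also P(x) = 0,
  and a common factor T - x can be cancelled (\<open>rational_imp_value_rational\<close>).

  Conversely, let the value be A / B in lowest terms, and write s(n) for the partial sums at 1/q.
  The numbers X(n) = B q^n (A/B - s(n)) are integers, and the p-adic size of the tail of the series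
  makes X(n) = p^\<psi>(n) R(n) with R(n) an integer. From one index to the next,
  p^(\<psi>(n+1) - \<psi>(n)) R(n+1) = q (R(n) - B a(n)).
  Here B and q are prime to p, so the digit a(n) is the residue of R(n) / B modulo p, hence R(n) is
  prime to p, and then the exponent on the left is the exact power of p in the right-hand side.
  Thus R(n) determines a(n), \<psi>(n+1) - \<psi>(n) and R(n+1). On the other hand, in the archimedean
  absolute value the recurrence multiplies R by at most q/p < 1 up to a bounded error, so R takes
  finitely many values. Hence R is eventually periodic, and with it the digits and the increments of
  \<psi>. The coefficients are then eventually multiplied by a constant power of p after each period,
  and the series is rational (\<open>value_rational_imp_rational\<close>).
\<close>

section \<open>The p-adic absolute value on the rationals\<close>

definition padic_null :: "nat \<Rightarrow> (nat \<Rightarrow> rat) \<Rightarrow> bool" where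
  "padic_null p u \<longleftrightarrow> (\<lambda>n. padic_abs p (u n)) \<longlonglongrightarrow> 0"

definition psum :: "rat fps \<Rightarrow> rat \<Rightarrow> nat \<Rightarrow> rat" where
  "psum F x N = (\<Sum>n<N. fps_nth F n * x ^ n)"

context
  fixes p :: nat
  assumes p: "prime p"
begin

lemma padic_abs_frac:
  assumes "a \<noteq> 0" "b \<noteq> 0"
  shows "padic_abs p (of_int a / of_int b) =
           real p ^ multiplicity (int p) b / real p ^ multiplicity (int p) a"
  using assms padic_val_quotient[OF p assms] prime_gt_0_nat[OF p]
  by (simp add: padic_abs_def power_int_diff)

lemma padic_abs_0 [simp]: "padic_abs p 0 = 0"
  by (simp add: padic_abs_def)

lemma padic_abs_nonneg [simp]: "padic_abs p x \<ge> 0"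
  by (simp add: padic_abs_def)

lemma padic_abs_mult: "padic_abs p (x * y) = padic_abs p x * padic_abs p y"
proof (cases "x = 0 \<or> y = 0")
  case False
  obtain a b where ab: "quotient_of x = (a, b)" by force
  obtain c d where cd: "quotient_of y = (c, d)" by force
  have x: "x = of_int a / of_int b" and y: "y = of_int c / of_int d"
    using quotient_of_div[OF ab] quotient_of_div[OF cd] by auto
  have nz: "a \<noteq> 0" "b \<noteq> 0" "c \<noteq> 0" "d \<noteq> 0"
    using False x y by auto
  have P: "prime_elem (int p)" using p by simp
  have xy: "x * y = of_int (a * c) / of_int (b * d)" by (simp add: x y)
  have "padic_abs p (x * y) = real p ^ (multiplicity (int p) (b * d)) /
      real p ^ (multiplicity (int p) (a * c))"
    unfolding xy by (rule padic_abs_frac) (use nz in auto)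
  also have "\<dots> = padic_abs p x * padic_abs p y"
    using nz by (simp add: x y padic_abs_frac prime_elem_multiplicity_mult_distrib[OF P] power_add)
  finally show ?thesis .
qed auto

lemma padic_abs_of_int:
  "padic_abs p (of_int a) = (if a = 0 then 0 else 1 / real p ^ multiplicity (int p) a)"
  using padic_abs_frac[of a 1] by simp

lemma padic_abs_of_int_le_1: "padic_abs p (of_int a) \<le> 1"
  using prime_ge_1_nat[OF p] by (simp add: padic_abs_of_int)

lemma padic_abs_1 [simp]: "padic_abs p 1 = 1"
  using padic_abs_of_int[of 1] by simp

lemma padic_abs_coprime: "\<not> int p dvd a \<Longrightarrow> padic_abs p (of_int a) = 1"
  by (auto simp: padic_abs_of_int not_dvd_imp_multiplicity_0)

lemma padic_abs_minus: "padic_abs p (- x) = padic_abs p x"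
proof -
  have "padic_abs p (- 1) = 1"
    using padic_abs_coprime[of "-1"] prime_gt_1_nat[OF p] by simp
  then show ?thesis using padic_abs_mult[of "-1" x] by simp
qed

lemma padic_abs_power: "padic_abs p (x ^ n) = padic_abs p x ^ n"
  by (induction n) (simp_all add: padic_abs_mult)

lemma padic_abs_p_power: "padic_abs p (of_nat p ^ n) = 1 / real p ^ n"
proof -
  have "multiplicity (int p) (int p) = 1"
    using p by (intro multiplicity_self) auto
  then have "padic_abs p (of_nat p) = 1 / real p"
    using padic_abs_of_int[of "int p"] prime_gt_0_nat[OF p] by simp
  then show ?thesis by (simp add: padic_abs_power power_one_over)
qed

lemma padic_abs_le_imp_dvd:
  assumes "padic_abs p (of_int a) \<le> 1 / real p ^ n"
  shows "int p ^ n dvd a"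
proof (cases "a = 0")
  case False
  have p1: "real p > 1" using prime_gt_1_nat[OF p] by simp
  have "1 / real p ^ multiplicity (int p) a \<le> 1 / real p ^ n"
    using assms False by (simp add: padic_abs_of_int)
  then have "real p ^ n \<le> real p ^ multiplicity (int p) a"
    using p1 by (simp add: field_simps)
  then have "n \<le> multiplicity (int p) a"
    using p1 by simp
  then show ?thesis by (rule multiplicity_dvd')
qed simp

lemma dvd_imp_padic_abs_le:
  assumes "int p ^ n dvd a"
  shows "padic_abs p (of_int a) \<le> 1 / real p ^ n"
proof -
  obtain c where "a = int p ^ n * c" using assms by blast
  then have "padic_abs p (of_int a) = 1 / real p ^ n * padic_abs p (of_int c)"
    by (simp add: padic_abs_mult padic_abs_p_power)
  also have "\<dots> \<le> 1 / real p ^ n" using padic_abs_of_int_le_1 by (intro mult_left_le) auto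
  finally show ?thesis .
qed

text \<open>Since q is a p-adic unit, the powers of 1/q leave the p-adic size of the terms unchanged.\<close>

lemma padic_abs_term_le:
  fixes q a :: int
  assumes "0 < q" "q < int p"
  shows "padic_abs p (of_int a * of_nat p ^ m * (1 / of_int q) ^ n) \<le> 1 / real p ^ m"
proof -
  have "padic_abs p (of_int q) = 1"
    using padic_abs_coprime assms zdvd_not_zless by blast
  moreover have "padic_abs p (of_int q * (1 / of_int q)) = 1" using assms by simp
  ultimately have "padic_abs p (1 / of_int q) = 1" unfolding padic_abs_mult by simp
  then show ?thesis
    unfolding padic_abs_mult padic_abs_power[of "1 / of_int q"] padic_abs_p_power
    using padic_abs_of_int_le_1[of a] by (simp add: divide_right_mono)
qed

lemma padic_abs_sum_le:
  assumes "\<And>i. i \<in> A \<Longrightarrow> padic_abs p (h i) \<le> C" "C \<ge> 0"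
  shows "padic_abs p (sum h A) \<le> C"
  using assms(1)
proof (induction A rule: infinite_finite_induct)
  case (insert x A)
  then show ?case using padic_abs_ultra[OF p, of "h x" "sum h A"] by force
qed (use assms(2) in auto)

section \<open>Null sequences and values of rational series\<close>

lemma padic_null_add:
  assumes "padic_null p u" "padic_null p v"
  shows "padic_null p (\<lambda>n. u n + v n)"
  unfolding padic_null_def
proof (rule Lim_null_comparison)
  show "(\<lambda>n. padic_abs p (u n) + padic_abs p (v n)) \<longlonglongrightarrow> 0"
    using assms unfolding padic_null_def by (rule tendsto_add_zero)
  have "padic_abs p (u n + v n) \<le> padic_abs p (u n) + padic_abs p (v n)" for n
    using padic_abs_ultra[OF p, of "u n" "v n"] padic_abs_nonneg[of "u n"]
      padic_abs_nonneg[of "v n"] by linarith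
  then show "\<forall>\<^sub>F n in sequentially. norm (padic_abs p (u n + v n))
      \<le> padic_abs p (u n) + padic_abs p (v n)"
    by simp
qed

lemma padic_null_cmult:
  "padic_null p u \<Longrightarrow> padic_null p (\<lambda>n. c * u n)"
  unfolding padic_null_def padic_abs_mult by (rule tendsto_mult_right_zero)

lemma padic_null_const: "padic_null p (\<lambda>_. c) \<longleftrightarrow> c = 0"
  using prime_gt_0_nat[OF p] by (auto simp: padic_null_def LIMSEQ_const_iff padic_abs_def)

lemma padic_null_Suc: "padic_null p (\<lambda>n. u (Suc n)) \<longleftrightarrow> padic_null p u"
  unfolding padic_null_def by (rule filterlim_sequentially_Suc)

lemma Qp_eval_of_rat_iff:
  "Qp_eval p F x (Qp_of_rat p r) \<longleftrightarrow> padic_null p (\<lambda>N. psum F x N - r)"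
proof -
  interpret Q: Metric_space "Qp p" "Qp_dist p" by (rule Metric_space_Qp[OF p])
  show ?thesis
    by (simp add: Qp_eval_def Q.limitin_metric_dist_null Qp_of_rat_mem[OF p] Qp_dist_of_rat[OF p]
        padic_null_def padic_dist_def psum_def)
qed

text \<open>By induction on the coefficients of Q: multiplying a series by T shifts its partial sums by one
  index, and the error of this shift is a multiple of a single term of F at x, which is null.\<close>

lemma psum_mult_poly:
  assumes "padic_null p (\<lambda>n. fps_nth F n * x ^ n)"
  shows "padic_null p (\<lambda>N. psum (F * fps_of_poly Q) x N - poly Q x * psum F x N)"
proof (induction Q)
  case 0
  then show ?case by (simp add: psum_def padic_null_const)
next
  case (pCons c Q)
  have F: "F * fps_of_poly (pCons c Q) = fps_const c * F + fps_X * (F * fps_of_poly Q)"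
    by (simp add: fps_of_poly_pCons algebra_simps)
  have shift: "psum (fps_X * H) x (Suc N) = x * psum H x N" for H N
    unfolding psum_def sum.lessThan_Suc_shift by (simp add: sum_distrib_left algebra_simps)
  have split: "psum (F * fps_of_poly (pCons c Q)) x (Suc N) =
      c * psum F x (Suc N) + x * psum (F * fps_of_poly Q) x N" for N
  proof -
    have "psum (F * fps_of_poly (pCons c Q)) x (Suc N) =
        c * psum F x (Suc N) + psum (fps_X * (F * fps_of_poly Q)) x (Suc N)"
      unfolding F unfolding psum_def
      by (simp only: fps_add_nth fps_mult_left_const_nth distrib_right sum.distrib
          sum_distrib_left mult.assoc)
    then show ?thesis by (simp only: shift)
  qed
  have "psum (F * fps_of_poly (pCons c Q)) x (Suc N) - poly (pCons c Q) x * psum F x (Suc N) =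
      x * (psum (F * fps_of_poly Q) x N - poly Q x * psum F x N) +
      (- x * poly Q x) * (fps_nth F N * x ^ N)" for N
    unfolding split by (simp add: psum_def algebra_simps)
  then have "padic_null p (\<lambda>N. psum (F * fps_of_poly (pCons c Q)) x (Suc N) -
      poly (pCons c Q) x * psum F x (Suc N))"
    using padic_null_add[OF padic_null_cmult[OF pCons.IH] padic_null_cmult[OF assms]] by presburger
  then show ?case by (simp only: padic_null_Suc[of "\<lambda>N. psum (F * fps_of_poly (pCons c Q)) x N -
      poly (pCons c Q) x * psum F x N"])
qed

lemma psum_fps_of_poly:
  "N > degree P \<Longrightarrow> psum (fps_of_poly P) x N = poly P x"
  unfolding psum_def poly_altdef fps_of_poly_nth
  by (intro sum.mono_neutral_right) (auto simp: coeff_eq_0)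

text \<open>The fraction need not be reduced, so its denominator may vanish at x; the induction on the degree
  of Q removes such common zeros one at a time.\<close>

lemma rational_imp_value_rational:
  assumes "fps_rational F" and null: "padic_null p (\<lambda>n. fps_nth F n * x ^ n)"
  shows "\<exists>r. Qp_eval p F x (Qp_of_rat p r)"
proof -
  obtain P Q where PQ: "coeff Q 0 \<noteq> 0" "F = fps_of_poly P / fps_of_poly Q"
    using assms(1) unfolding fps_rational_def by blast
  have "fps_nth (fps_of_poly Q) 0 \<noteq> 0" using PQ by simp
  then have "is_unit (fps_of_poly Q)" by simp
  then have "F * fps_of_poly Q = fps_of_poly P" using PQ(2) by simp
  then show ?thesis using PQ(1)
  proof (induction "degree Q" arbitrary: P Q rule: less_induct)
    case less
    have "eventually (\<lambda>N. psum (F * fps_of_poly Q) x N = poly P x) sequentially"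
      using eventually_gt_at_top[of "degree P"]
      by eventually_elim (simp add: less.prems(1) psum_fps_of_poly)
    then have ev: "eventually (\<lambda>N. padic_abs p (psum (F * fps_of_poly Q) x N - poly Q x * psum F x N)
        = padic_abs p (poly P x - poly Q x * psum F x N)) sequentially"
      by eventually_elim simp
    have lim: "padic_null p (\<lambda>N. poly P x - poly Q x * psum F x N)"
      using psum_mult_poly[OF null, of Q] unfolding padic_null_def filterlim_cong[OF refl refl ev] .
    show ?case
    proof (cases "poly Q x = 0")
      case False
      have "padic_null p (\<lambda>N. - (1 / poly Q x) * (poly P x - poly Q x * psum F x N))"
        by (rule padic_null_cmult[OF lim])
      moreover have "- (1 / poly Q x) * (poly P x - poly Q x * psum F x N) =
          psum F x N - poly P x / poly Q x" for N
        using False by (simp add: field_simps)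
      ultimately show ?thesis unfolding Qp_eval_of_rat_iff by auto
    next
      case True
      then have "poly P x = 0" using lim by (simp add: padic_null_const)
      then obtain P' Q' where P': "P = [:- x, 1:] * P'" and Q': "Q = [:- x, 1:] * Q'"
        using True by (auto simp: poly_eq_0_iff_dvd elim!: dvdE)
      have nz: "Q' \<noteq> 0" using less.prems(2) Q' by auto
      have "degree Q' < degree Q"
        unfolding Q' using nz by (subst degree_mult_eq) auto
      moreover have "F * fps_of_poly Q' = fps_of_poly P'"
      proof -
        have "fps_of_poly [:- x, 1:] * (F * fps_of_poly Q') = fps_of_poly [:- x, 1:] * fps_of_poly P'"
          using less.prems(1) unfolding P' Q' fps_of_poly_mult by (simp add: algebra_simps)
        moreover have "fps_of_poly [:- x, 1:] \<noteq> 0" by (simp del: fps_of_poly_pCons)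
        ultimately show ?thesis using mult_left_cancel by blast
      qed
      moreover have "coeff Q' 0 \<noteq> 0" using less.prems(2) unfolding Q' by auto
      ultimately show ?thesis by (rule less.hyps)
    qed
  qed
qed

end

section \<open>Eventual periodicity and rationality\<close>

lemma fps_eventually_zero_imp_poly:
  fixes H :: "'a::comm_ring_1 fps"
  assumes "\<And>n. n \<ge> N \<Longrightarrow> fps_nth H n = 0"
  shows "H = fps_of_poly (\<Sum>i<N. monom (fps_nth H i) i)"
proof (rule fps_ext)
  fix n
  have "(\<Sum>i<N. if i = n then fps_nth H i else 0) = fps_nth H n"
    using assms[of n] by (auto simp: sum.delta)
  then show "fps_nth H n = fps_nth (fps_of_poly (\<Sum>i<N. monom (fps_nth H i) i)) n"
    by (simp add: coeff_sum)
qed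

text \<open>Multiplication by 1 - c T^k annihilates all but finitely many coefficients.\<close>

lemma fps_rational_geometric_periodic:
  fixes F :: "'a::field fps"
  assumes "k > 0" and "\<And>n. n \<ge> M \<Longrightarrow> fps_nth F (n + k) = c * fps_nth F n"
  shows "fps_rational F"
proof -
  define Q :: "'a poly" where "Q = 1 - monom c k"
  have Q0: "coeff Q 0 = 1" using assms(1) by (simp add: Q_def)
  have "fps_nth (F * fps_of_poly Q) n = 0" if "n \<ge> M + k" for n
  proof -
    have "F * fps_of_poly Q = F - fps_const c * (F * fps_X ^ k)"
      by (simp add: Q_def fps_of_poly_diff fps_of_poly_monom algebra_simps)
    then show ?thesis
      using assms(2)[of "n - k"] that by (simp add: fps_X_power_mult_right_nth)
  qed
  then obtain P where P: "F * fps_of_poly Q = fps_of_poly P"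
    using fps_eventually_zero_imp_poly by blast
  have "fps_nth (fps_of_poly Q) 0 \<noteq> 0" using Q0 by simp
  then have "is_unit (fps_of_poly Q)" by simp
  then have "F = fps_of_poly P / fps_of_poly Q" unfolding P[symmetric] by fastforce
  then show ?thesis unfolding fps_rational_def using Q0 by (intro exI[of _ P] exI[of _ Q]) simp
qed

text \<open>Two indices share a value by the pigeonhole principle, and from there on the sequence repeats.\<close>

lemma deterministic_bounded_periodic:
  fixes R :: "nat \<Rightarrow> int"
  assumes bound: "\<And>n. \<bar>R n\<bar> \<le> C"
    and det: "\<And>m n. R m = R n \<Longrightarrow> R (Suc m) = R (Suc n)"
  shows "\<exists>M k. k > 0 \<and> (\<forall>n\<ge>M. R (n + k) = R n)"
proof -
  have "range R \<subseteq> {- C..C}" using bound by (auto simp: abs_le_iff minus_le_iff)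
  then have "finite (range R)" by (rule finite_subset) simp
  then have "\<not> inj R" using finite_imageD infinite_UNIV_nat by blast
  then obtain i j where ij: "R i = R j" "i < j"
    unfolding inj_def by (metis linorder_neqE_nat)
  have "R (n + (j - i)) = R n" if "n \<ge> i" for n
    using that
  proof (induction n rule: dec_induct)
    case base then show ?case using ij by simp
  next
    case (step n) then show ?case using det[OF step.IH] by simp
  qed
  then show ?thesis using ij(2) by (intro exI[of _ i] exI[of _ "j - i"]) simp
qed

section \<open>The recurrence for the remainders\<close>

lemma digit_eq:
  fixes B a b :: int
  assumes "prime p" "\<not> int p dvd B" "a \<in> {1..int p - 1}" "b \<in> {1..int p - 1}"
    "int p dvd R - B * a" "int p dvd R - B * b"
  shows "a = b"
proof -
  have "int p dvd (R - B * b) - (R - B * a)" using assms(6,5) by (rule dvd_diff)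
  then have "int p dvd B * (a - b)" by (simp add: algebra_simps)
  then have "int p dvd a - b" using assms(1,2) prime_dvd_mult_iff[of "int p"] by auto
  then show ?thesis using assms(3,4) zdvd_not_zless[of "a - b" "int p"] zdvd_not_zless[of "b - a" "int p"]
    by (cases "a < b"; cases "a = b") (auto simp: dvd_diff_commute)
qed

lemma prime_power_mult_unique:
  fixes r s :: int
  assumes "prime p" "\<not> int p dvd r" "\<not> int p dvd s" "int p ^ d * r = int p ^ e * s"
  shows "d = e" "r = s"
proof -
  have P: "int p \<noteq> 0" using assms(1) by auto
  have aux: "e' \<le> d'" if "int p ^ d' * r' = int p ^ e' * s'" "\<not> int p dvd r'" for d' e' r' s'
  proof (rule ccontr)
    assume "\<not> e' \<le> d'"
    then have "e' = d' + Suc (e' - d' - 1)" by simp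
    then have "int p ^ d' * r' = int p ^ d' * (int p * (int p ^ (e' - d' - 1) * s'))"
      using that(1) by (metis mult.assoc power_Suc power_add)
    then have "r' = int p * (int p ^ (e' - d' - 1) * s')" using P by simp
    then show False using that(2) by (metis dvd_triv_left)
  qed
  show "d = e" using aux[OF assms(4,2)] aux[OF assms(4)[symmetric] assms(3)] by simp
  then show "r = s" using assms(4) P by simp
qed

text \<open>The step of the archimedean estimate, with Y in the role of a power of P. Since q < P, a bound C Y
  for X yields the bound C P Y for the next term as soon as C absorbs the contribution q B P of the
  digit a: then q C + q B P \<le> (q + 1) C \<le> P C.\<close>

lemma bounded_step:
  fixes q P A B X a C :: int
  assumes "0 < q" "q < P" "0 < B" "0 \<le> a" "a \<le> P" "\<bar>X\<bar> \<le> C * Y" "q * B * P \<le> C" "Y \<ge> 0"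
  shows "\<bar>q * (X - B * a * Y)\<bar> \<le> C * (P * Y)"
proof -
  have "\<bar>X - B * a * Y\<bar> \<le> \<bar>X\<bar> + \<bar>B * a * Y\<bar>" by simp
  also have "\<bar>B * a * Y\<bar> = B * a * Y" using assms by simp
  also have "B * a * Y \<le> B * P * Y" using assms by (intro mult_right_mono mult_left_mono) auto
  finally have "\<bar>X - B * a * Y\<bar> \<le> (C + B * P) * Y" using assms(6) by (simp add: algebra_simps)
  then have "q * \<bar>X - B * a * Y\<bar> \<le> q * ((C + B * P) * Y)" using assms by (intro mult_left_mono) auto
  also have "\<dots> = (q * C + q * B * P) * Y" by (simp add: algebra_simps)
  also have "\<dots> \<le> (q * C + C) * Y" using assms by (intro mult_right_mono) auto
  also have "\<dots> \<le> (P * C) * Y"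
  proof (intro mult_right_mono)
    have "C \<ge> 0" using assms by (smt (verit) mult_nonneg_nonneg)
    then have "(q + 1) * C \<le> P * C" using assms by (intro mult_right_mono) auto
    then show "q * C + C \<le> P * C" by (simp add: algebra_simps)
  qed (use assms in auto)
  finally show ?thesis using assms(1) by (simp add: abs_mult mult.assoc mult.left_commute)
qed

text \<open>The sequence R below plays the part of the successive remainders in a p-adic division of A by B,
  whose repetition makes the expansion periodic.\<close>

lemma value_rational_imp_rational:
  fixes p :: nat and q :: int and f :: "nat \<Rightarrow> nat" and a :: "nat \<Rightarrow> int" and F :: "rat fps"
  assumes p: "prime p" and q: "0 < q" "q < int p" and f: "strict_mono f"
    and a: "\<And>n. a n \<in> {1..int p - 1}"
    and F: "\<And>n. fps_nth F n = of_int (a n) * of_nat p ^ f n"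
    and r: "Qp_eval p F (1 / of_int q) (Qp_of_rat p r)"
  shows "fps_rational F"
proof -
  define S where "S = psum F (1 / of_int q)"
  have p0: "p > 0" and p1: "p > 1" using p prime_gt_0_nat prime_gt_1_nat by auto
  have q_cop: "\<not> int p dvd q" using q zdvd_not_zless by blast
  have summand: "padic_abs p (fps_nth F n * (1 / of_int q) ^ n) \<le> 1 / real p ^ f n" for n
    unfolding F by (rule padic_abs_term_le[OF p q])

  \<comment> \<open>Only the limit of the partial sums is known, so the tail is compared with a finite one.\<close>
  have tail: "padic_abs p (r - S N) \<le> 1 / real p ^ f N" for N
  proof -
    have pos: "1 / real p ^ f N > 0" using p0 by simp
    have "(\<lambda>n. padic_abs p (S n - r)) \<longlonglongrightarrow> 0"
      using r unfolding Qp_eval_of_rat_iff[OF p] padic_null_def S_def .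
    from order_tendstoD(2)[OF this pos] have "\<forall>\<^sub>F n in sequentially. padic_abs p (S n - r) < 1 / real p ^ f N"
      by simp
    then obtain n where n: "padic_abs p (S n - r) < 1 / real p ^ f N" "n \<ge> N"
      using eventually_happens'[OF sequentially_bot eventually_conj[OF _ eventually_ge_at_top[of N]]]
      by blast
    have "S n - S N = (\<Sum>i\<in>{N..<n}. fps_nth F i * (1 / of_int q) ^ i)"
      unfolding S_def psum_def lessThan_atLeast0 using n(2) by (intro sum_diff_nat_ivl) auto
    also have "padic_abs p \<dots> \<le> 1 / real p ^ f N"
    proof (rule padic_abs_sum_le[OF p])
      fix i assume "i \<in> {N..<n}"
      then have "f N \<le> f i" using f by (simp add: strict_mono_less_eq)
      then have "1 / real p ^ f i \<le> 1 / real p ^ f N"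
        using p1 by (intro divide_left_mono power_increasing) auto
      then show "padic_abs p (fps_nth F i * (1 / of_int q) ^ i) \<le> 1 / real p ^ f N"
        using summand[of i] by simp
    qed simp
    finally have "padic_abs p (S n - S N) \<le> 1 / real p ^ f N" .
    moreover have "padic_abs p (r - S n) < 1 / real p ^ f N"
      using n(1) padic_abs_minus[OF p, of "S n - r"] by simp
    ultimately show ?thesis
      using padic_abs_ultra[OF p, of "r - S n" "S n - S N"] by simp
  qed

  obtain A B where AB: "quotient_of r = (A, B)" by force
  have r_eq: "r = of_int A / of_int B" and B: "B > 0" and cop: "coprime A B"
    using quotient_of_div[OF AB] quotient_of_denom_pos[OF AB] quotient_of_coprime[OF AB] by auto

  \<comment> \<open>Defined by recursion, X is visibly integral; its closed form in terms of \<open>r\<close> follows.\<close>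
  define X where "X = rec_nat A (\<lambda>n x. q * (x - B * a n * int p ^ f n))"
  have X_0: "X 0 = A" and X_Suc: "X (Suc n) = q * (X n - B * a n * int p ^ f n)" for n
    by (simp_all add: X_def)
  have X: "of_int (X n) = of_int B * (of_int q ^ n * (r - S n))" for n
  proof (induction n)
    case 0 show ?case using B by (simp add: X_0 S_def psum_def r_eq)
  next
    case (Suc n)
    have "S (Suc n) = S n + of_int (a n) * of_nat p ^ f n / of_int q ^ n"
      by (simp add: S_def psum_def F power_one_over field_simps)
    then show ?case using q by (simp add: X_Suc Suc.IH field_simps)
  qed
  have X_abs: "padic_abs p (of_int (X n)) \<le> padic_abs p (of_int B) * (1 / real p ^ f n)" for n
    unfolding X padic_abs_mult[OF p] padic_abs_power[OF p, of "of_int q"] padic_abs_coprime[OF p q_cop]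
    using mult_left_mono[OF tail padic_abs_nonneg[OF p]] by simp
  \<comment> \<open>A convergent series of p-adic integers has a p-adically integral value.\<close>
  have B_cop: "\<not> int p dvd B"
  proof
    assume pB: "int p dvd B"
    have "padic_abs p (of_int A) \<le> padic_abs p (of_int B) * (1 / real p ^ f 0)"
      using X_abs[of 0] unfolding X_0 .
    also have "\<dots> \<le> padic_abs p (of_int B)"
      using p1 padic_abs_nonneg[OF p] by (intro mult_left_le) auto
    also have "\<dots> \<le> 1 / real p ^ 1"
      using pB by (intro dvd_imp_padic_abs_le[OF p]) simp
    finally have "padic_abs p (of_int A) \<le> 1 / real p ^ 1" .
    then have "int p dvd A" using padic_abs_le_imp_dvd[OF p, of A 1] by simp
    then show False using pB coprime_common_divisor[OF cop, of "int p"] p1 by simp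
  qed
  have "int p ^ f n dvd X n" for n
    using X_abs[of n] by (intro padic_abs_le_imp_dvd[OF p]) (simp add: padic_abs_coprime[OF p B_cop])
  then obtain R where R: "X n = int p ^ f n * R n" for n unfolding dvd_def by metis

  have f_Suc: "f n < f (Suc n)" for n using f by (simp add: strict_mono_Suc_iff)
  have R_Suc: "int p ^ (f (Suc n) - f n) * R (Suc n) = q * (R n - B * a n)" for n
  proof -
    have "int p ^ f n * (int p ^ (f (Suc n) - f n) * R (Suc n)) = X (Suc n)"
      using f_Suc[of n] by (simp add: R mult.assoc[symmetric] power_add[symmetric])
    also have "\<dots> = int p ^ f n * (q * (R n - B * a n))"
      unfolding X_Suc R[of n] by (simp add: algebra_simps)
    finally show ?thesis using p0 by (subst (asm) mult_cancel_left) simp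
  qed
  \<comment> \<open>Strict monotonicity of \<open>f\<close> puts a positive power of \<open>p\<close> on the left of \<open>R_Suc\<close>.\<close>
  have cong: "int p dvd R n - B * a n" for n
  proof -
    have "int p dvd int p ^ (f (Suc n) - f n) * R (Suc n)"
      using f_Suc[of n] by (intro dvd_mult2) (simp add: dvd_power)
    then show ?thesis unfolding R_Suc using q_cop p by (simp add: prime_dvd_mult_iff)
  qed
  have R_cop: "\<not> int p dvd R n" for n
  proof
    assume "int p dvd R n"
    then have "int p dvd R n - (R n - B * a n)" by (rule dvd_diff[OF _ cong])
    then have "int p dvd a n" using B_cop p by (simp add: prime_dvd_mult_iff)
    then show False using a[of n] zdvd_not_zless[of "a n" "int p"] by auto
  qed

  have det: "a m = a n \<and> f (Suc m) - f m = f (Suc n) - f n \<and> R (Suc m) = R (Suc n)"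
    if "R m = R n" for m n
  proof -
    have *: "a m = a n"
      using digit_eq[OF p B_cop a a, of "R n" m n] cong[of m] cong[of n] that by simp
    then have "int p ^ (f (Suc m) - f m) * R (Suc m) = int p ^ (f (Suc n) - f n) * R (Suc n)"
      using that by (simp add: R_Suc)
    from prime_power_mult_unique[OF p R_cop R_cop this] * show ?thesis by simp
  qed

  define C where "C = \<bar>A\<bar> + q * B * int p"
  have C0: "C \<ge> 0" using q B by (simp add: C_def)
  have X_bound: "\<bar>X n\<bar> \<le> C * int p ^ f n" for n
  proof (induction n)
    case 0
    have "\<bar>A\<bar> \<le> C" using q B by (simp add: C_def)
    also have "C \<le> C * int p ^ f 0"
      using mult_left_mono[of 1 "int p ^ f 0" C] C0 p0 by simp
    finally show ?case by (simp add: X_0)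
  next
    case (Suc n)
    have "\<bar>X (Suc n)\<bar> \<le> C * (int p * int p ^ f n)"
      unfolding X_Suc using q B a[of n] Suc.IH by (intro bounded_step) (auto simp: C_def)
    \<comment> \<open>A gap larger than 1 only weakens the bound.\<close>
    also have "\<dots> \<le> C * int p ^ f (Suc n)"
    proof (intro mult_left_mono)
      have "int p ^ Suc (f n) \<le> int p ^ f (Suc n)"
        using f_Suc[of n] p1 by (intro power_increasing) auto
      then show "int p * int p ^ f n \<le> int p ^ f (Suc n)" by simp
    qed (rule C0)
    finally show ?case .
  qed
  have R_bound: "\<bar>R n\<bar> \<le> C" for n
    using X_bound[of n] p0 by (simp add: R abs_mult mult.commute)

  have R_det: "R (Suc m) = R (Suc n)" if "R m = R n" for m n using det[OF that] by blast
  obtain M k where k: "k > 0" and per: "\<And>n. n \<ge> M \<Longrightarrow> R (n + k) = R n"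
    using deterministic_bounded_periodic[of R, OF R_bound R_det] by blast
  have f_per: "f (n + k) = f n + (f (M + k) - f M)" if "n \<ge> M" for n
    using that
  proof (induction n rule: dec_induct)
    case base
    then show ?case using f by (simp add: strict_mono_less_eq)
  next
    case (step n)
    have "f (Suc (n + k)) - f (n + k) = f (Suc n) - f n"
      using det[OF per[OF step.hyps(1)]] by simp
    then show ?case using step.IH f_Suc[of n] f_Suc[of "n + k"] by simp
  qed
  show ?thesis
  proof (rule fps_rational_geometric_periodic[OF k])
    fix n assume "n \<ge> M"
    then show "fps_nth F (n + k) = of_nat p ^ (f (M + k) - f M) * fps_nth F n"
      using det[OF per] f_per[of n] by (simp add: F power_add)
  qed
qed

section \<open>Rationality of the series and of its value\<close>

theorem mainTheorem2:
  fixes p :: nat and q :: int and \<psi> :: "nat \<Rightarrow> enat" and a :: "nat \<Rightarrow> int"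
  assumes "prime p"
    and "1 < q" and "q < int p"
    and "admissible \<psi>"
    and "\<And>n. \<psi> n \<noteq> \<infinity> \<Longrightarrow> a n \<in> {1..int p - 1}"
  shows "fps_rational (G_series p \<psi> a) \<longleftrightarrow>
         (\<exists>r. Qp_eval p (G_series p \<psi> a) (1 / of_int q) (Qp_of_rat p r))"
proof (cases "\<exists>N. {i. \<psi> i \<noteq> \<infinity>} = {i. i \<le> N}")
  case True
  then obtain N where N: "{i. \<psi> i \<noteq> \<infinity>} = {i. i \<le> N}" by blast
  have zero: "fps_nth (G_series p \<psi> a) n = 0" if "n \<ge> Suc N" for n
  proof -
    have "n \<notin> {i. \<psi> i \<noteq> \<infinity>}" unfolding N using that by simp
    then show ?thesis by (simp add: G_series_def)
  qed
  obtain P where "G_series p \<psi> a = fps_of_poly P"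
    using fps_eventually_zero_imp_poly zero by blast
  then have rat: "fps_rational (G_series p \<psi> a)"
    unfolding fps_rational_def by (intro exI[of _ P] exI[of _ 1]) simp
  have "\<forall>\<^sub>F n in sequentially. padic_abs p (fps_nth (G_series p \<psi> a) n * (1 / of_int q) ^ n) = 0"
    using eventually_ge_at_top[of "Suc N"] by eventually_elim (simp add: zero padic_abs_def)
  then have "padic_null p (\<lambda>n. fps_nth (G_series p \<psi> a) n * (1 / of_int q) ^ n)"
    unfolding padic_null_def by (rule tendsto_eventually)
  with rat show ?thesis using rational_imp_value_rational[OF assms(1)] by blast
next
  case False
  then have fin: "\<psi> i \<noteq> \<infinity>" and mono: "strict_mono_on UNIV \<psi>" for i
    using assms(4) unfolding admissible_def by auto
  define f where "f = the_enat \<circ> \<psi>"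
  have psi: "\<psi> i = enat (f i)" for i using fin[of i] by (auto simp: f_def)
  have f: "strict_mono f"
    using mono by (auto simp: strict_mono_on_def strict_mono_def psi)
  have G: "fps_nth (G_series p \<psi> a) n = of_int (a n) * of_nat p ^ f n" for n
    by (simp add: G_series_def psi)
  show ?thesis
  proof
    assume rat: "fps_rational (G_series p \<psi> a)"
    have p1: "real p > 1" using prime_gt_1_nat[OF assms(1)] by simp
    have le: "padic_abs p (fps_nth (G_series p \<psi> a) n * (1 / of_int q) ^ n) \<le> (1 / real p) ^ n" for n
    proof -
      have "1 / real p ^ f n \<le> 1 / real p ^ n"
        using p1 f by (intro divide_left_mono power_increasing strict_mono_imp_increasing) auto
      then show ?thesis
        using padic_abs_term_le[OF assms(1) _ assms(3), of "a n" "f n" n] assms(2)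
        by (simp add: G power_one_over)
    qed
    have lim: "(\<lambda>n. (1 / real p) ^ n) \<longlonglongrightarrow> 0"
      using p1 by (intro LIMSEQ_realpow_zero) auto
    have "padic_null p (\<lambda>n. fps_nth (G_series p \<psi> a) n * (1 / of_int q) ^ n)"
      unfolding padic_null_def
    proof (rule tendsto_sandwich[OF _ _ tendsto_const lim])
      show "\<forall>\<^sub>F n in sequentially.
          0 \<le> padic_abs p (fps_nth (G_series p \<psi> a) n * (1 / of_int q) ^ n)"
        by (simp add: padic_abs_nonneg[OF assms(1)])
    qed (simp add: le)
    with rat show "\<exists>r. Qp_eval p (G_series p \<psi> a) (1 / of_int q) (Qp_of_rat p r)"
      using rational_imp_value_rational[OF assms(1)] by blast
  next
    assume "\<exists>r. Qp_eval p (G_series p \<psi> a) (1 / of_int q) (Qp_of_rat p r)"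
    then obtain r where r: "Qp_eval p (G_series p \<psi> a) (1 / of_int q) (Qp_of_rat p r)" by blast
    show "fps_rational (G_series p \<psi> a)"
      by (rule value_rational_imp_rational[OF assms(1) _ assms(3) f _ G r])
        (use assms(2,5) fin in auto)
  qed
qed

end
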